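(* Let $k\in\{3,4,5\}$. (a) For every metric space $(X,\rho)$, every fractal structure $\mathbf{\Gamma}=\{\Gamma_n\}_{n\in\mathbb{N}}$ on $X$ and every $F\subseteq X$ with $\delta(F,\Gamma_n)\to 0$ as $n\to\infty$, one has $\inf\{s\geq 0:\mathcal{H}^s_k(F)=0\}=\sup\{s\geq 0:\mathcal{H}^s_k(F)=\infty\}$. (b) Without the hypothesis $\delta(F,\Gamma_n)\to 0$ this equality fails in general: there exist a metric space $(X,\rho)$, a fractal structure $\mathbf{\Gamma}$ on $X$ and $F\subseteq X$ such that $\delta(F,\Gamma_n)\not\to 0$ and $\inf\{s\geq 0:\mathcal{H}^s_k(F)=0\}\neq\sup\{s\geq 0:\mathcal{H}^s_k(F)=\infty\}$.
   Context: Fractal structures. A covering of a set $X$ is a family $\Gamma$ of subsets of $X$ with union $X$; the same set is allowed to appear several times in a covering, and sums over elements of a covering are taken with multiplicity. $\Gamma_1\prec\Gamma_2$ means that each $A\in\Gamma_1$ is contained in some $B\in\Gamma_2$; $\Gamma_1\prec\prec\Gamma_2$ means that $\Gamma_1\prec\Gamma_2$ and for all $B\in\Gamma_2$, $B=\bigcup\{A\in\Gamma_1:A\subseteq B\}$. A fractal structure on $X$ is a sequence $\mathbf{\Gamma}=\{\Gamma_n\}_{n\in\mathbb{N}}$ of coverings of $X$ with $\Gamma_{n+1}\prec\prec\Gamma_n$ for all $n$. For a metric space $(X,\rho)$ with a fractal structure $\mathbf{\Gamma}$ and $F\subseteq X$, put $\operatorname{diam}(A)=\sup\{\rho(x,y):x,y\in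 A\}$ and $\delta(F,\Gamma_n)=\sup\{\operatorname{diam}(A):A\in\Gamma_n,\ A\cap F\neq\emptyset\}$. For $s\ge 0$ and $n\in\mathbb{N}$ put $$\mathcal{H}^s_{n,k}(F)=\inf\Big\{\sum_{j\in J}\operatorname{diam}(A_j)^s:\{A_j\}_{j\in J}\in\mathcal{A}_{n,k}(F)\Big\},\qquad \mathcal{H}^s_k(F)=\lim_{n\to\infty}\mathcal{H}^s_{n,k}(F),$$ where $\mathcal{A}_{n,3}(F)=\{\{A\in\Gamma_l:A\cap F\neq\emptyset\}:l\ge n\}$; $\mathcal{A}_{n,4}(F)$ is the collection of all finite families $\{A_j\}_{j\in J}$ of elements of $\bigcup_{l\ge n}\Gamma_l$ with $F\subseteq\bigcup_{j\in J}A_j$; $\mathcal{A}_{n,5}(F)$ is the collection of all countable families $\{A_j\}_{j\in J}$ of elements of $\bigcup_{l\ge n}\Gamma_l$ with $F\subseteq\bigcup_{j\in J}A_j$. Conventions: $\inf\emptyset=\infty$ and, for subsets of $[0,\infty)$, $\sup\emptyset=0$. *)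

theory Defs
  imports "HOL-Analysis.Analysis"
begin

text \<open>Families are indexed, so that a set may occur several times in a covering; the index set
  is arbitrary, possibly uncountable.\<close>

type_synonym ('i, 'a) family = "'i set \<times> ('i \<Rightarrow> 'a set)"

definition members :: "('i, 'a) family \<Rightarrow> 'a set set" where
  "members \<C> = snd \<C> ` fst \<C>"

definition covering :: "'a set \<Rightarrow> ('i, 'a) family \<Rightarrow> bool" where
  "covering X \<C> \<longleftrightarrow> \<Union>(members \<C>) = X"

definition refines :: "('i, 'a) family \<Rightarrow> ('j, 'a) family \<Rightarrow> bool" where
  "refines \<C> \<D> \<longleftrightarrow> (\<forall>A\<in>members \<C>. \<exists>B\<in>members \<D>. A \<subseteq> B)"

definition strongly_refines :: "('i, 'a) family \<Rightarrow> ('j, 'a) family \<Rightarrow> bool" where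
  "strongly_refines \<C> \<D> \<longleftrightarrow>
     refines \<C> \<D> \<and> (\<forall>B\<in>members \<D>. B = \<Union>{A \<in> members \<C>. A \<subseteq> B})"

definition fractal_structure :: "'a set \<Rightarrow> (nat \<Rightarrow> ('i, 'a) family) \<Rightarrow> bool" where
  "fractal_structure X \<Gamma> \<longleftrightarrow>
     (\<forall>n. covering X (\<Gamma> n)) \<and> (\<forall>n. strongly_refines (\<Gamma> (Suc n)) (\<Gamma> n))"

text \<open>Diameters, sums and dimensions live in \<open>[0, \<infinity>]\<close>; there \<open>Sup {} = 0\<close> and \<open>Inf {} = \<infinity>\<close>.\<close>

definition diam :: "('a \<Rightarrow> 'a \<Rightarrow> real) \<Rightarrow> 'a set \<Rightarrow> ennreal" where
  "diam \<rho> A = Sup {ennreal (\<rho> x y) | x y. x \<in> A \<and> y \<in> A}"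

definition delta :: "('a \<Rightarrow> 'a \<Rightarrow> real) \<Rightarrow> 'a set \<Rightarrow> ('i, 'a) family \<Rightarrow> ennreal" where
  "delta \<rho> F \<C> = Sup {diam \<rho> A | A. A \<in> members \<C> \<and> A \<inter> F \<noteq> {}}"

text \<open>Real powers on \<open>[0, \<infinity>]\<close>, with the convention \<open>x\<^sup>0 = 1\<close> for every \<open>x\<close>
  (including \<open>0\<close> and \<open>\<infinity>\<close>), and \<open>\<infinity>\<^sup>s = \<infinity>\<close> for \<open>s > 0\<close>.\<close>

definition epow :: "ennreal \<Rightarrow> real \<Rightarrow> ennreal" where
  "epow x s = (if s = 0 then 1 else if x = \<infinity> then \<infinity> else ennreal (enn2real x powr s))"

definition diam_sum :: "('a \<Rightarrow> 'a \<Rightarrow> real) \<Rightarrow> real \<Rightarrow> ('i, 'a) family \<Rightarrow> ennreal" where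
  "diam_sum \<rho> s \<C> = (\<Sum>\<^sub>\<infinity>j\<in>fst \<C>. epow (diam \<rho> (snd \<C> j)) s)"

definition meeting :: "'a set \<Rightarrow> ('i, 'a) family \<Rightarrow> ('i, 'a) family" where
  "meeting F \<C> = ({i \<in> fst \<C>. snd \<C> i \<inter> F \<noteq> {}}, snd \<C>)"

definition covers3 :: "(nat \<Rightarrow> ('i, 'a) family) \<Rightarrow> nat \<Rightarrow> 'a set \<Rightarrow> ('i, 'a) family set" where
  "covers3 \<Gamma> n F = {meeting F (\<Gamma> l) | l. l \<ge> n}"

text \<open>Every finite or countable family can be reindexed by a set of natural numbers, so the
  index type \<^typ>\<open>nat\<close> is no restriction below. Countable includes finite.\<close>

definition covers5 :: "(nat \<Rightarrow> ('i, 'a) family) \<Rightarrow> nat \<Rightarrow> 'a set \<Rightarrow> (nat, 'a) family set" where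
  "covers5 \<Gamma> n F = {\<C>. members \<C> \<subseteq> (\<Union>l\<in>{n..}. members (\<Gamma> l)) \<and> F \<subseteq> \<Union>(members \<C>)}"

definition covers4 :: "(nat \<Rightarrow> ('i, 'a) family) \<Rightarrow> nat \<Rightarrow> 'a set \<Rightarrow> (nat, 'a) family set" where
  "covers4 \<Gamma> n F = {\<C> \<in> covers5 \<Gamma> n F. finite (fst \<C>)}"

text \<open>Only the values \<open>k = 3, 4, 5\<close> are meaningful.\<close>

definition Hpre ::
  "('a \<Rightarrow> 'a \<Rightarrow> real) \<Rightarrow> (nat \<Rightarrow> ('i, 'a) family) \<Rightarrow> nat \<Rightarrow> real \<Rightarrow> nat \<Rightarrow> 'a set \<Rightarrow> ennreal" where
  "Hpre \<rho> \<Gamma> k s n F =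
     (if k = 3 then Inf (diam_sum \<rho> s ` covers3 \<Gamma> n F)
      else if k = 4 then Inf (diam_sum \<rho> s ` covers4 \<Gamma> n F)
      else Inf (diam_sum \<rho> s ` covers5 \<Gamma> n F))"

definition Hlim ::
  "('a \<Rightarrow> 'a \<Rightarrow> real) \<Rightarrow> (nat \<Rightarrow> ('i, 'a) family) \<Rightarrow> nat \<Rightarrow> real \<Rightarrow> 'a set \<Rightarrow> ennreal" where
  "Hlim \<rho> \<Gamma> k s F = lim (\<lambda>n. Hpre \<rho> \<Gamma> k s n F)"

lemma Hpre_incseq: "incseq (\<lambda>n. Hpre \<rho> \<Gamma> k s n F)"
proof (rule incseq_SucI)
  fix n
  have "covers3 \<Gamma> (Suc n) F \<subseteq> covers3 \<Gamma> n F"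
    unfolding covers3_def by (auto intro: Suc_leD)
  moreover have 5: "covers5 \<Gamma> (Suc n) F \<subseteq> covers5 \<Gamma> n F"
  proof -
    have "(\<Union>l\<in>{Suc n..}. members (\<Gamma> l)) \<subseteq> (\<Union>l\<in>{n..}. members (\<Gamma> l))"
      by (rule UN_mono) auto
    then show ?thesis unfolding covers5_def by blast
  qed
  moreover have "covers4 \<Gamma> (Suc n) F \<subseteq> covers4 \<Gamma> n F"
    using 5 unfolding covers4_def by blast
  ultimately show "Hpre \<rho> \<Gamma> k s n F \<le> Hpre \<rho> \<Gamma> k s (Suc n) F"
    unfolding Hpre_def by (simp add: Inf_superset_mono image_mono)
qed

lemma Hpre_tendsto_Hlim: "(\<lambda>n. Hpre \<rho> \<Gamma> k s n F) \<longlonglongrightarrow> Hlim \<rho> \<Gamma> k s F"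
  unfolding Hlim_def using LIMSEQ_SUP[OF Hpre_incseq] limI by metis

definition inf_zero ::
  "('a \<Rightarrow> 'a \<Rightarrow> real) \<Rightarrow> (nat \<Rightarrow> ('i, 'a) family) \<Rightarrow> nat \<Rightarrow> 'a set \<Rightarrow> ennreal" where
  "inf_zero \<rho> \<Gamma> k F = Inf (ennreal ` {s. s \<ge> 0 \<and> Hlim \<rho> \<Gamma> k s F = 0})"

definition sup_infinite ::
  "('a \<Rightarrow> 'a \<Rightarrow> real) \<Rightarrow> (nat \<Rightarrow> ('i, 'a) family) \<Rightarrow> nat \<Rightarrow> 'a set \<Rightarrow> ennreal" where
  "sup_infinite \<rho> \<Gamma> k F = Sup (ennreal ` {s. s \<ge> 0 \<and> Hlim \<rho> \<Gamma> k s F = \<infinity>})"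

end

theory Submission imports Defs begin

text \<open>If the sets in play have diameter at most \<open>\<epsilon>\<close>, then raising the exponent from \<open>s\<close> to \<open>t > s\<close>
  shrinks every sum by the factor \<open>\<epsilon>\<^sup>t\<^sup>-\<^sup>s\<close>. Members of a cover that miss \<open>F\<close> may be large, but they
  can be discarded. So \<open>\<delta>(F, \<Gamma>\<^sub>n) \<longlonglongrightarrow> 0\<close> forces \<open>H\<^sup>t = 0\<close> as soon as \<open>H\<^sup>s < \<infinity>\<close> for some \<open>s < t\<close>, and the
  two critical exponents agree. Conversely, if every level of the structure is the single set
  \<open>{0, 1}\<close>, then \<open>H\<^sup>s = 1\<close> for all \<open>s\<close>, so the infimum is \<open>\<infinity>\<close> and the supremum is \<open>0\<close>.\<close>

section \<open>Sums of powers under a change of exponent\<close>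

text \<open>Split off the factor \<open>r powr (t - s)\<close>, which is monotone in
  \<open>r\<close> because the exponent is positive.\<close>

lemma epow_le_mult:
  assumes "x \<le> ennreal e" "0 \<le> e" "0 \<le> s" "s < t"
  shows "epow x t \<le> ennreal (e powr (t - s)) * epow x s"
proof -
  obtain r where r: "x = ennreal r" "0 \<le> r" "r \<le> e"
    using assms(1,2) by (cases x) (auto simp: top_unique)
  \<comment> \<open>The base 0 is treated apart: \<open>epow\<close> is 1 at base 0 and exponent 0,
    whereas \<open>0 powr 0 = 0\<close>.\<close>
  show ?thesis
  proof (cases "r = 0")
    case True
    then show ?thesis using r assms by (simp add: epow_def)
  next
    case False
    have "r powr t = r powr (t - s) * r powr s"
      by (simp flip: powr_add)
    also have "\<dots> \<le> e powr (t - s) * r powr s"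
      using r assms by (intro mult_right_mono powr_mono2) auto
    finally show ?thesis
      using r assms False by (auto simp: epow_def ennreal_mult'[symmetric] ennreal_leI)
  qed
qed

text \<open>An infinite sum in \<open>ennreal\<close> is the supremum of its finite partial sums,
  and multiplication by a constant commutes with suprema.\<close>

lemma infsum_mult_left_ennreal:
  fixes c :: ennreal
  shows "(\<Sum>\<^sub>\<infinity>x\<in>A. c * f x) = c * (\<Sum>\<^sub>\<infinity>x\<in>A. f x)"
  by (simp add: nonneg_infsum_complete SUP_mult_left_ennreal flip: sum_distrib_left)

lemma diam_sum_le_mult:
  assumes "\<And>A. A \<in> members \<C> \<Longrightarrow> diam \<rho> A \<le> ennreal e" "0 \<le> e" "0 \<le> s" "s < t"
  shows "diam_sum \<rho> t \<C> \<le> ennreal (e powr (t - s)) * diam_sum \<rho> s \<C>"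
proof -
  have "diam_sum \<rho> t \<C>
      \<le> (\<Sum>\<^sub>\<infinity>j\<in>fst \<C>. ennreal (e powr (t - s)) * epow (diam \<rho> (snd \<C> j)) s)"
    unfolding diam_sum_def using assms
    by (intro infsum_mono epow_le_mult nonneg_summable_on_complete) (auto simp: members_def)
  also have "\<dots> = ennreal (e powr (t - s)) * diam_sum \<rho> s \<C>"
    unfolding diam_sum_def by (rule infsum_mult_left_ennreal)
  finally show ?thesis .
qed

section \<open>Discarding the members that miss \<open>F\<close>\<close>

lemma diam_sum_meeting_le: "diam_sum \<rho> s (meeting F \<C>) \<le> diam_sum \<rho> s \<C>"
  unfolding diam_sum_def meeting_def by (intro infsum_mono_neutral nonneg_summable_on_complete) auto

lemma members_meeting: "members (meeting F \<C>) = {A \<in> members \<C>. A \<inter> F \<noteq> {}}"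
  by (auto simp: members_def meeting_def)

text \<open>\<open>meeting F\<close> is idempotent, and every family in \<open>covers3\<close> is
  already of this form.\<close>

lemma meeting_covers3:
  fixes \<C> :: "('i, 'a) family"
  assumes "\<C> \<in> covers3 \<Gamma> n F"
  shows "meeting F \<C> \<in> covers3 \<Gamma> n F"
proof -
  obtain l where l: "l \<ge> n" "\<C> = meeting F (\<Gamma> l)"
    using assms by (auto simp: covers3_def)
  then have "meeting F \<C> = meeting F (\<Gamma> l)"
    by (auto simp: meeting_def)
  with l(1) show ?thesis
    unfolding covers3_def by blast
qed

text \<open>A member containing a point of \<open>F\<close> meets \<open>F\<close>, so no point of
  \<open>F\<close> becomes uncovered.\<close>

lemma meeting_covers5:
  assumes "\<C> \<in> covers5 \<Gamma> n F"
  shows "meeting F \<C> \<in> covers5 \<Gamma> n F"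
proof -
  have "F \<subseteq> \<Union>(members (meeting F \<C>))"
  proof
    fix x assume "x \<in> F"
    then obtain A where "A \<in> members \<C>" "x \<in> A"
      using assms unfolding covers5_def by blast
    with \<open>x \<in> F\<close> show "x \<in> \<Union>(members (meeting F \<C>))"
      unfolding members_meeting by blast
  qed
  moreover have "members (meeting F \<C>) \<subseteq> members \<C>"
    unfolding members_meeting by blast
  ultimately show ?thesis
    using assms unfolding covers5_def by blast
qed

lemma meeting_covers4:
  assumes "\<C> \<in> covers4 \<Gamma> n F"
  shows "meeting F \<C> \<in> covers4 \<Gamma> n F"
proof -
  have "finite (fst (meeting F \<C>))"
    using assms by (simp add: covers4_def meeting_def)
  with assms show ?thesis
    unfolding covers4_def by (blast intro: meeting_covers5)
qed

lemma members_covers3: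
  assumes "\<C> \<in> covers3 \<Gamma> n F"
  shows "members \<C> \<subseteq> (\<Union>l\<in>{n..}. members (\<Gamma> l))"
proof -
  obtain l where "l \<ge> n" "\<C> = meeting F (\<Gamma> l)"
    using assms unfolding covers3_def by blast
  then show ?thesis
    using members_meeting[of F "\<Gamma> l"] by auto
qed

lemma members_covers5:
  "\<C> \<in> covers5 \<Gamma> n F \<Longrightarrow> members \<C> \<subseteq> (\<Union>l\<in>{n..}. members (\<Gamma> l))"
  unfolding covers5_def by blast

section \<open>From single covers to infima and limits\<close>

text \<open>The class \<open>K\<close> is left abstract to serve \<open>covers3\<close>,
  \<open>covers4\<close> and \<open>covers5\<close> alike. Its closure under
  \<open>meeting F\<close> is what brings \<open>delta\<close> into play, since \<open>delta\<close>
  bounds only diameters of sets that meet \<open>F\<close>.\<close>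

lemma Inf_diam_sum_le:
  assumes small: "\<And>l. l \<ge> n \<Longrightarrow> delta \<rho> F (\<Gamma> l) \<le> ennreal e"
    and meet: "\<And>\<C>. \<C> \<in> K \<Longrightarrow> meeting F \<C> \<in> K"
    and mem: "\<And>\<C>. \<C> \<in> K \<Longrightarrow> members \<C> \<subseteq> (\<Union>l\<in>{n..}. members (\<Gamma> l))"
    and "0 \<le> e" "0 \<le> s" "s < t"
    and "Inf (diam_sum \<rho> s ` K) < M"
  shows "Inf (diam_sum \<rho> t ` K) \<le> ennreal (e powr (t - s)) * M"
proof -
  \<comment> \<open>The infimum need not be attained; the strict bound \<open>M\<close> still yields
    an actual cover.\<close>
  obtain \<C> where \<C>: "\<C> \<in> K" "diam_sum \<rho> s \<C> < M"
    using assms(7) by (auto simp: Inf_less_iff)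
  have diam_le: "diam \<rho> A \<le> ennreal e" if A: "A \<in> members (meeting F \<C>)" for A
  proof -
    obtain l where "l \<ge> n" "A \<in> members (\<Gamma> l)" "A \<inter> F \<noteq> {}"
      using A mem[OF \<C>(1)] by (auto simp: members_meeting)
    then have "diam \<rho> A \<le> delta \<rho> F (\<Gamma> l)"
      unfolding delta_def by (intro Sup_upper) auto
    also have "\<dots> \<le> ennreal e" using small \<open>l \<ge> n\<close> .
    finally show ?thesis .
  qed
  have "Inf (diam_sum \<rho> t ` K) \<le> diam_sum \<rho> t (meeting F \<C>)"
    using meet[OF \<C>(1)] by (intro Inf_lower) auto
  also have "\<dots> \<le> ennreal (e powr (t - s)) * diam_sum \<rho> s (meeting F \<C>)"
    using diam_le assms by (intro diam_sum_le_mult) auto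
  also have "\<dots> \<le> ennreal (e powr (t - s)) * M"
    using diam_sum_meeting_le[of \<rho> s F \<C>] \<C>(2) by (intro mult_left_mono) auto
  finally show ?thesis .
qed

lemma Hpre_le_mult:
  assumes "\<And>l. l \<ge> n \<Longrightarrow> delta \<rho> F (\<Gamma> l) \<le> ennreal e" "0 \<le> e" "0 \<le> s" "s < t"
    and "Hpre \<rho> \<Gamma> k s n F < M"
  shows "Hpre \<rho> \<Gamma> k t n F \<le> ennreal (e powr (t - s)) * M"
proof -
  have sub: "covers4 \<Gamma> n F \<subseteq> covers5 \<Gamma> n F"
    by (auto simp: covers4_def)
  \<comment> \<open>The last case takes in every remaining \<open>k\<close>, as does the final
    branch of \<open>Hpre\<close>.\<close>
  consider "k = 3" | "k \<noteq> 3" "k = 4" | "k \<noteq> 3" "k \<noteq> 4" by blast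
  then show ?thesis
  proof cases
    case 1
    have "Inf (diam_sum \<rho> s ` covers3 \<Gamma> n F) < M"
      using 1 assms(5) by (simp add: Hpre_def)
    then have "Inf (diam_sum \<rho> t ` covers3 \<Gamma> n F) \<le> ennreal (e powr (t - s)) * M"
      by (rule Inf_diam_sum_le[OF assms(1) meeting_covers3 members_covers3 assms(2-4), rotated -1])
    with 1 show ?thesis by (simp add: Hpre_def)
  next
    case 2
    have "Inf (diam_sum \<rho> s ` covers4 \<Gamma> n F) < M"
      using 2 assms(5) by (simp add: Hpre_def)
    then have "Inf (diam_sum \<rho> t ` covers4 \<Gamma> n F) \<le> ennreal (e powr (t - s)) * M"
      by (rule Inf_diam_sum_le[OF assms(1) meeting_covers4 members_covers5[OF subsetD[OF sub]] assms(2-4), rotated -1])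
    with 2 show ?thesis by (simp add: Hpre_def)
  next
    case 3
    have "Inf (diam_sum \<rho> s ` covers5 \<Gamma> n F) < M"
      using 3 assms(5) by (simp add: Hpre_def)
    then have "Inf (diam_sum \<rho> t ` covers5 \<Gamma> n F) \<le> ennreal (e powr (t - s)) * M"
      by (rule Inf_diam_sum_le[OF assms(1) meeting_covers5 members_covers5 assms(2-4), rotated -1])
    with 3 show ?thesis by (simp add: Hpre_def)
  qed
qed

text \<open>At exponent \<open>s\<close> the values \<open>Hpre\<close> stay below a fixed
  \<open>m\<close>, while the factor in \<open>Hpre_le_mult\<close> becomes arbitrarily small at
  late levels.\<close>

lemma Hlim_eq_0_if_finite:
  assumes lim: "(\<lambda>n. delta \<rho> F (\<Gamma> n)) \<longlonglongrightarrow> 0"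
    and "0 \<le> s" "s < t" and fin: "Hlim \<rho> \<Gamma> k s F \<noteq> \<infinity>"
  shows "Hlim \<rho> \<Gamma> k t F = 0"
proof -
  obtain h where h: "Hlim \<rho> \<Gamma> k s F = ennreal h" "0 \<le> h"
    using fin by (metis ennreal_cases infinity_ennreal_def)
  \<comment> \<open>Adding 1 makes the bound strict, and positive even if
    \<open>h = 0\<close>.\<close>
  define m where "m = h + 1"
  have "m > 0" using h by (simp add: m_def)
  have bound: "Hpre \<rho> \<Gamma> k s n F < ennreal m" for n
  proof -
    have "Hpre \<rho> \<Gamma> k s n F \<le> ennreal h"
      unfolding h(1)[symmetric] by (rule incseq_le[OF Hpre_incseq Hpre_tendsto_Hlim])
    also have "\<dots> < ennreal m" using h by (simp add: m_def ennreal_lessI)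
    finally show ?thesis .
  qed
  have "Hpre \<rho> \<Gamma> k t n F = 0" for n
  proof -
    have "Hpre \<rho> \<Gamma> k t n F \<le> 0 + ennreal \<eta>" if "\<eta> > 0" for \<eta>
    proof -
      \<comment> \<open>This \<open>e\<close> solves
        \<open>e powr (t - s) * m = \<eta>\<close>.\<close>
      define e where "e = (\<eta> / m) powr (1 / (t - s))"
      have "e > 0" using \<open>\<eta> > 0\<close> \<open>m > 0\<close> by (simp add: e_def)
      have "e powr (t - s) = \<eta> / m"
        using \<open>\<eta> > 0\<close> \<open>m > 0\<close> \<open>s < t\<close> by (simp add: e_def powr_powr)
      then have "e powr (t - s) * m = \<eta>"
        using \<open>m > 0\<close> by simp
      then have em: "ennreal (e powr (t - s)) * ennreal m = ennreal \<eta>"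
        using ennreal_mult[of "e powr (t - s)" m] \<open>m > 0\<close> by simp
      have "\<forall>\<^sub>F l in sequentially. delta \<rho> F (\<Gamma> l) < ennreal e"
        using order_tendstoD(2)[OF lim] \<open>e > 0\<close> by simp
      then obtain N where N: "\<And>l. l \<ge> N \<Longrightarrow> delta \<rho> F (\<Gamma> l) < ennreal e"
        unfolding eventually_sequentially by blast
      \<comment> \<open>Since \<open>Hpre\<close> increases with the level, it suffices to bound it
        at a level where \<open>delta\<close> is already below \<open>e\<close>.\<close>
      have "Hpre \<rho> \<Gamma> k t n F \<le> Hpre \<rho> \<Gamma> k t (max n N) F"
        by (rule incseqD[OF Hpre_incseq]) simp
      also have "\<dots> \<le> ennreal (e powr (t - s)) * ennreal m"
      proof (rule Hpre_le_mult[OF _ _ assms(2,3) bound])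
        show "delta \<rho> F (\<Gamma> l) \<le> ennreal e" if "l \<ge> max n N" for l
          using N[of l] that by simp
        show "0 \<le> e" using \<open>e > 0\<close> by simp
      qed
      finally show ?thesis using em by simp
    qed
    then have "Hpre \<rho> \<Gamma> k t n F \<le> 0"
      by (rule ennreal_le_epsilon)
    then show ?thesis by simp
  qed
  then have "(\<lambda>n. Hpre \<rho> \<Gamma> k t n F) = (\<lambda>_. 0)"
    by (rule ext)
  then show ?thesis
    using Hpre_tendsto_Hlim[of \<rho> \<Gamma> k t F] LIMSEQ_unique tendsto_const by metis
qed

section \<open>Equality of the critical exponents\<close>

lemma inf_zero_eq_sup_infinite:
  assumes lim: "(\<lambda>n. delta \<rho> F (\<Gamma> n)) \<longlonglongrightarrow> 0"
  shows "inf_zero \<rho> \<Gamma> k F = sup_infinite \<rho> \<Gamma> k F"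
proof (rule antisym)
  show "inf_zero \<rho> \<Gamma> k F \<le> sup_infinite \<rho> \<Gamma> k F"
  proof (rule ccontr)
    assume "\<not> ?thesis"
    \<comment> \<open>Two exponents are placed in the gap: finiteness at the smaller one gives the
      value 0 only at strictly larger ones.\<close>
    then obtain y where y: "sup_infinite \<rho> \<Gamma> k F < y" "y < inf_zero \<rho> \<Gamma> k F"
      by (meson dense not_le)
    then obtain x where x: "sup_infinite \<rho> \<Gamma> k F < x" "x < y"
      by (meson dense)
    obtain t where t: "y = ennreal t" "0 \<le> t"
      using y(2) by (cases y) auto
    obtain s where s: "x = ennreal s" "0 \<le> s"
      using x(2) by (cases x) auto
    have "s < t" using x(2) s t by (simp add: ennreal_less_iff)
    have "Hlim \<rho> \<Gamma> k s F \<noteq> \<infinity>"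
    proof
      assume "Hlim \<rho> \<Gamma> k s F = \<infinity>"
      then have "x \<le> sup_infinite \<rho> \<Gamma> k F"
        unfolding sup_infinite_def using s by (intro Sup_upper) auto
      then show False using x(1) by simp
    qed
    then have "Hlim \<rho> \<Gamma> k t F = 0"
      by (rule Hlim_eq_0_if_finite[OF lim s(2) \<open>s < t\<close>])
    then have "inf_zero \<rho> \<Gamma> k F \<le> y"
      unfolding inf_zero_def using t by (intro Inf_lower) auto
    then show False using y(2) by simp
  qed
  \<comment> \<open>If \<open>s < t\<close>, the value 0 at \<open>s\<close> is finite and would
    force 0, not \<infinity>, at \<open>t\<close>.\<close>
  show "sup_infinite \<rho> \<Gamma> k F \<le> inf_zero \<rho> \<Gamma> k F"
    unfolding sup_infinite_def inf_zero_def
  proof (intro Sup_least Inf_greatest, elim imageE CollectE conjE, hypsubst)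
    fix t s
    assume "0 \<le> s" "Hlim \<rho> \<Gamma> k s F = 0" "Hlim \<rho> \<Gamma> k t F = \<infinity>"
    then have "\<not> s < t"
      using Hlim_eq_0_if_finite[OF lim \<open>0 \<le> s\<close>, of t k] by auto
    then show "ennreal t \<le> ennreal s"
      by (simp add: ennreal_leI)
  qed
qed

section \<open>The counterexample with a constant structure\<close>

text \<open>This is why the counterexample has diameter 1: the sums do not depend on
  \<open>s\<close>.\<close>

lemma epow_1: "epow 1 s = 1"
  by (simp add: epow_def)

lemma diam_sum_singleton:
  "diam \<rho> A = 1 \<Longrightarrow> diam_sum \<rho> s ({i}, \<lambda>_. A) = 1"
  by (simp add: diam_sum_def epow_1)

lemma one_le_diam_sum:
  assumes "j \<in> fst \<C>" "diam \<rho> (snd \<C> j) = 1"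
  shows "1 \<le> diam_sum \<rho> s \<C>"
proof -
  have "1 = (\<Sum>\<^sub>\<infinity>j\<in>{j}. epow (diam \<rho> (snd \<C> j)) s)"
    by (simp add: assms(2) epow_1)
  also have "\<dots> \<le> diam_sum \<rho> s \<C>"
    unfolding diam_sum_def using assms(1)
    by (intro infsum_mono_neutral nonneg_summable_on_complete) auto
  finally show ?thesis .
qed

text \<open>\<open>A\<close> is the only set available at any level, so every cover of the nonempty
  \<open>A\<close> uses it and has sum at least 1; using it once attains 1.\<close>

lemma Hlim_const_family:
  fixes A :: "'a set" and i :: 'i
  assumes "A \<noteq> {}" and diam: "diam \<rho> A = 1"
  shows "Hlim \<rho> (\<lambda>_. ({i}, \<lambda>_. A)) k s A = 1"
proof -
  define \<Gamma> :: "nat \<Rightarrow> ('i, 'a) family" where "\<Gamma> = (\<lambda>_. ({i}, \<lambda>_. A))"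
  have mem: "(\<Union>l\<in>{n..}. members (\<Gamma> l)) = {A}" for n
    by (auto simp: members_def \<Gamma>_def)
  have le: "1 \<le> diam_sum \<rho> s \<C>" if \<C>: "\<C> \<in> covers5 \<Gamma> n A" for \<C> n
  proof -
    have sub: "members \<C> \<subseteq> {A}" "A \<subseteq> \<Union>(members \<C>)"
      using \<C> unfolding covers5_def mem by blast+
    then have "A \<in> members \<C>"
      using assms(1) by blast
    then obtain j where "j \<in> fst \<C>" "snd \<C> j = A"
      unfolding members_def by blast
    then show ?thesis
      using diam by (simp add: one_le_diam_sum)
  qed
  have "members ({0 :: nat}, \<lambda>_. A) = {A}"
    by (simp add: members_def)
  then have single: "({0}, \<lambda>_. A) \<in> covers4 \<Gamma> n A" for n
    by (simp add: covers4_def covers5_def mem)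
  have sub: "covers4 \<Gamma> n A \<subseteq> covers5 \<Gamma> n A" for n
    unfolding covers4_def by blast
  \<comment> \<open>Sandwiching \<open>K\<close> handles \<open>covers4\<close> and
    \<open>covers5\<close> together: the upper bound comes from a finite cover, the lower one holds
    for all countable covers.\<close>
  have Inf_eq: "Inf (diam_sum \<rho> s ` K) = 1"
    if "covers4 \<Gamma> n A \<subseteq> K" "K \<subseteq> covers5 \<Gamma> n A" for K n
  proof (rule antisym)
    have "Inf (diam_sum \<rho> s ` K) \<le> diam_sum \<rho> s ({0 :: nat}, \<lambda>_. A)"
      by (rule INF_lower[OF subsetD[OF that(1) single]])
    also have "\<dots> = 1" by (rule diam_sum_singleton[OF diam])
    finally show "Inf (diam_sum \<rho> s ` K) \<le> 1" .
    show "1 \<le> Inf (diam_sum \<rho> s ` K)"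
      by (rule INF_greatest) (rule le[OF subsetD[OF that(2)]])
  qed
  have "covers3 \<Gamma> n A = {({i}, \<lambda>_. A)}" for n
    using assms(1) by (auto simp: covers3_def meeting_def \<Gamma>_def)
  then have "Inf (diam_sum \<rho> s ` covers3 \<Gamma> n A) = 1" for n
    by (simp add: diam_sum_singleton[OF diam])
  then have "Hpre \<rho> \<Gamma> k s n A = 1" for n
    unfolding Hpre_def Inf_eq[OF order_refl sub] Inf_eq[OF sub order_refl] by simp
  then have "(\<lambda>n. Hpre \<rho> \<Gamma> k s n A) = (\<lambda>_. 1)"
    by (rule ext)
  then have "Hlim \<rho> \<Gamma> k s A = 1"
    using Hpre_tendsto_Hlim[of \<rho> \<Gamma> k s A] LIMSEQ_unique tendsto_const by metis
  then show ?thesis unfolding \<Gamma>_def .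
qed

lemma fractal_structure_const: "fractal_structure X (\<lambda>_. ({i}, \<lambda>_. X))"
  by (auto simp: fractal_structure_def covering_def strongly_refines_def refines_def members_def)

text \<open>Both sets of exponents are empty, so the infimum is \<open>top\<close> and the supremum
  is \<open>bot\<close>.\<close>

lemma inf_zero_neq_sup_infinite_const:
  assumes "A \<noteq> {}" "diam \<rho> A = 1"
  shows "inf_zero \<rho> (\<lambda>_. ({i}, \<lambda>_. A)) k A \<noteq> sup_infinite \<rho> (\<lambda>_. ({i}, \<lambda>_. A)) k A"
  by (simp add: inf_zero_def sup_infinite_def Hlim_const_family[OF assms] bot_ennreal)

lemma diam_dist_01: "diam dist {0, 1 :: real} = 1"
  unfolding diam_def
proof (rule antisym)
  show "Sup {ennreal (dist x y) | x y. x \<in> {0, 1 :: real} \<and> y \<in> {0, 1 :: real}} \<le> 1"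
    by (rule Sup_least) auto
  have "1 = ennreal (dist 0 (1 :: real))" by simp
  then show "1 \<le> Sup {ennreal (dist x y) | x y. x \<in> {0, 1 :: real} \<and> y \<in> {0, 1 :: real}}"
    by (intro Sup_upper) blast
qed

theorem mainTheorem3:
  fixes k :: nat
  assumes "k \<in> {3, 4, 5}"
  shows
    "(\<forall>(X :: 'a set) \<rho> (\<Gamma> :: nat \<Rightarrow> ('i, 'a) family) F.
        Metric_space X \<rho> \<longrightarrow> fractal_structure X \<Gamma> \<longrightarrow> F \<subseteq> X \<longrightarrow>
        (\<lambda>n. delta \<rho> F (\<Gamma> n)) \<longlonglongrightarrow> 0 \<longrightarrow>
        inf_zero \<rho> \<Gamma> k F = sup_infinite \<rho> \<Gamma> k F) \<and>
     (\<exists>(X :: real set) \<rho> (\<Gamma> :: nat \<Rightarrow> (nat, real) family) F.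
        Metric_space X \<rho> \<and> fractal_structure X \<Gamma> \<and> F \<subseteq> X \<and>
        \<not> (\<lambda>n. delta \<rho> F (\<Gamma> n)) \<longlonglongrightarrow> 0 \<and>
        inf_zero \<rho> \<Gamma> k F \<noteq> sup_infinite \<rho> \<Gamma> k F)"
proof (intro conjI allI impI)
  fix X :: "'a set" and \<rho> and \<Gamma> :: "nat \<Rightarrow> ('i, 'a) family" and F
  assume "(\<lambda>n. delta \<rho> F (\<Gamma> n)) \<longlonglongrightarrow> 0"
  then show "inf_zero \<rho> \<Gamma> k F = sup_infinite \<rho> \<Gamma> k F"
    by (rule inf_zero_eq_sup_infinite)
next
  \<comment> \<open>The two-point space serves both as \<open>X\<close> and as
    \<open>F\<close>.\<close>
  define A :: "real set" where "A = {0, 1}"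
  define \<Gamma> :: "nat \<Rightarrow> (nat, real) family" where "\<Gamma> = (\<lambda>_. ({0}, \<lambda>_. A))"
  have A: "A \<noteq> {}" "diam dist A = 1"
    by (simp_all add: A_def diam_dist_01)
  have "Metric_space A dist"
    by unfold_locales (auto simp: dist_commute dist_triangle)
  moreover have "fractal_structure A \<Gamma>"
    unfolding \<Gamma>_def by (rule fractal_structure_const)
  moreover have "delta dist A (\<Gamma> n) = 1" for n
  proof -
    have "{diam dist B | B. B \<in> members (\<Gamma> n) \<and> B \<inter> A \<noteq> {}} = {1}"
      using A by (auto simp: members_def \<Gamma>_def)
    then show ?thesis by (simp add: delta_def)
  qed
  then have "\<not> (\<lambda>n. delta dist A (\<Gamma> n)) \<longlonglongrightarrow> 0"
    using LIMSEQ_const_iff[of "1 :: ennreal" 0] by simp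
  moreover have "inf_zero dist \<Gamma> k A \<noteq> sup_infinite dist \<Gamma> k A"
    unfolding \<Gamma>_def by (rule inf_zero_neq_sup_infinite_const[OF A])
  ultimately show "\<exists>(X :: real set) \<rho> (\<Gamma> :: nat \<Rightarrow> (nat, real) family) F.
        Metric_space X \<rho> \<and> fractal_structure X \<Gamma> \<and> F \<subseteq> X \<and>
        \<not> (\<lambda>n. delta \<rho> F (\<Gamma> n)) \<longlonglongrightarrow> 0 \<and>
        inf_zero \<rho> \<Gamma> k F \<noteq> sup_infinite \<rho> \<Gamma> k F"
    by blast
qed

end
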